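(* Let $\zeta\in\mathbb{C}$. The polar Legendre polynomial $P_n$ with pole $\zeta$ verifies $$\int_{-1}^1 \left[P_{n}(x)+(x-\zeta)P_{n}'(x) \right] L_m(x)\, dx= \begin{cases} 0, & m \neq n, \\ (n+1)\|L_n\|^2, & m=n. \end{cases}$$ Additionally, if $n>0$ then $$\int_{-1}^{1} (x-\zeta)P_{n}(x) L_m(x)\,dx = \begin{cases} \frac{2}{n}(1-\zeta^2) L_n'(\zeta), & m=0, \\ 0, & 0 < m < n-1, \\ - \frac{n+1}{n}\|L_n\|^2, & m=n-1, \\ 0, & m=n ,\\ \|L_{n+1}\|^2, & m=n+1, \\ 0, & n+1<m. \end{cases}$$
   Context: For $n=0,1,2,\dots$, $L_n$ denotes the monic Legendre polynomial of degree $n$, i.e. the monic polynomial of degree $n$ with $\int_{-1}^1 L_n(x)x^k\,dx=0$ for $k=0,\dots,n-1$, and $\|L_n\|^2=\int_{-1}^1 L_n(x)^2\,dx$. For a fixed $\zeta\in\mathbb{C}$ (the pole), the $n$-th polar Legendre polynomial $P_n=P_{\zeta,n}$ is the monic polynomial of degree $n$ determined by $(n+1)L_n(z)=\left((z-\zeta)P_n(z)\right)'$, equivalently $(z-\zeta)P_n(z)=(n+1)\int_\zeta^z L_n(t)\,dt$.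
   Formalization: For n=1, m=0 the cases m=0 and m=n-1 overlap and give conflicting values 2(1-ζ²) and -4/3, while the integral is 2/3-2ζ²; there the value is taken as the sum of the two printed expressions. All other cases are as stated. *)

theory Defs
  imports "HOL-Analysis.Analysis" "HOL-Computational_Algebra.Polynomial"
begin

definition is_monic_legendre :: "nat \<Rightarrow> real poly \<Rightarrow> bool" where
  "is_monic_legendre n p \<longleftrightarrow>
     degree p = n \<and> lead_coeff p = 1 \<and>
     (\<forall>k<n. integral {-1..1} (\<lambda>x. poly p x * x ^ k) = 0)"

definition monic_legendre :: "nat \<Rightarrow> real poly" where
  "monic_legendre n = (THE p. is_monic_legendre n p)"

definition legendre_norm_sq :: "nat \<Rightarrow> real" where
  "legendre_norm_sq n = integral {-1..1} (\<lambda>x. (poly (monic_legendre n) x)\<^sup>2)"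

definition complex_poly :: "real poly \<Rightarrow> complex poly" where
  "complex_poly p = map_poly complex_of_real p"

definition is_polar_legendre :: "complex \<Rightarrow> nat \<Rightarrow> complex poly \<Rightarrow> bool" where
  "is_polar_legendre \<zeta> n p \<longleftrightarrow>
     degree p = n \<and> lead_coeff p = 1 \<and>
     smult (of_nat (n + 1)) (complex_poly (monic_legendre n)) = pderiv ([:- \<zeta>, 1:] * p)"

definition polar_legendre :: "complex \<Rightarrow> nat \<Rightarrow> complex poly" where
  "polar_legendre \<zeta> n = (THE p. is_polar_legendre \<zeta> n p)"

text \<open>Both definite descriptions above denote: existence and uniqueness are proved below.\<close>

lemma integrable_poly_prod: "(\<lambda>x::real. poly p x * poly q x) integrable_on {-1..1}"
  by (intro integrable_continuous_interval continuous_intros)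

lemma legendre_orth_lower:
  assumes "is_monic_legendre n p" and "degree q < n \<or> q = 0"
  shows "integral {-1..1} (\<lambda>x. poly p x * poly q x) = 0"
proof (cases "q = 0")
  case False
  have "integral {-1..1} (\<lambda>x. poly p x * poly q x) =
      integral {-1..1} (\<lambda>x. \<Sum>k\<le>degree q. coeff q k * (poly p x * x ^ k))"
    by (intro integral_cong) (simp add: poly_altdef sum_distrib_left mult_ac)
  also have "\<dots> = (\<Sum>k\<le>degree q. integral {-1..1} (\<lambda>x. coeff q k * (poly p x * x ^ k)))"
    by (intro integral_sum finite_atMost integrable_continuous_interval continuous_intros)
  also have "\<dots> = 0"
    using assms False by (intro sum.neutral) (auto simp: is_monic_legendre_def)
  finally show ?thesis .
qed simp

lemma poly_sq_integral_eq_0: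
  fixes p :: "real poly"
  assumes "integral {-1..1} (\<lambda>x. poly p x * poly p x) = 0"
  shows "p = 0"
proof (rule ccontr)
  assume "p \<noteq> 0"
  have "\<forall>x\<in>{-1..1}. poly p x * poly p x = 0"
    using assms by (subst (asm) integral_eq_0_iff) (auto intro!: continuous_intros)
  then have "{-1..1} \<subseteq> {x. poly p x = 0}" by auto
  then have "finite {-1..1::real}"
    using poly_roots_finite[OF \<open>p \<noteq> 0\<close>] finite_subset by blast
  then show False by (simp add: infinite_Icc_iff[THEN iffD2])
qed

lemma degree_diff_monic:
  fixes p q :: "'a :: comm_ring_1 poly"
  assumes "degree p = n" "degree q = n" "lead_coeff p = 1" "lead_coeff q = 1" "p \<noteq> q"
  shows "degree (p - q) < n"
proof -
  have "degree (p - q) \<le> n"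
    using assms by (intro degree_diff_le) auto
  moreover have "coeff (p - q) n = 0" using assms by simp
  ultimately show ?thesis
    using assms(5) by (metis leading_coeff_0_iff nat_less_le right_minus_eq)
qed

lemma is_monic_legendre_unique:
  assumes "is_monic_legendre n p" and "is_monic_legendre n q"
  shows "p = q"
proof (rule ccontr)
  assume "p \<noteq> q"
  then have d: "degree (p - q) < n"
    using assms by (intro degree_diff_monic) (auto simp: is_monic_legendre_def)
  have "integral {-1..1} (\<lambda>x. poly (p - q) x * poly (p - q) x) =
     integral {-1..1} (\<lambda>x. poly p x * poly (p - q) x - poly q x * poly (p - q) x)"
    by (simp add: algebra_simps)
  also have "\<dots> = integral {-1..1} (\<lambda>x. poly p x * poly (p - q) x) -
     integral {-1..1} (\<lambda>x. poly q x * poly (p - q) x)"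
    by (intro integral_diff integrable_poly_prod)
  also have "\<dots> = 0"
    using legendre_orth_lower[OF assms(1), of "p - q"] legendre_orth_lower[OF assms(2), of "p - q"] d
    by simp
  finally have "p - q = 0" by (rule poly_sq_integral_eq_0)
  with \<open>p \<noteq> q\<close> show False by simp
qed

lemma ex_is_monic_legendre: "\<exists>p. is_monic_legendre n p"
proof (induction n rule: less_induct)
  case (less n)
  then obtain l where l: "is_monic_legendre k (l k)" if "k < n" for k by metis
  define ip where "ip p q = integral {-1..1} (\<lambda>x. poly p x * poly q x)" for p q :: "real poly"
  have ip_diff: "ip (p - q) r = ip p r - ip q r" for p q r
    unfolding ip_def by (simp add: left_diff_distrib integral_diff integrable_poly_prod)
  have ip_commute: "ip p q = ip q p" for p q by (simp add: ip_def mult.commute)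
  have ip_smult: "ip (smult c p) r = c * ip p r" for c p r
    by (simp add: ip_def mult.assoc)
  have ip_sum: "ip (\<Sum>k<n. f k) r = (\<Sum>k<n. ip (f k) r)" for f r
    unfolding ip_def poly_sum sum_distrib_right
    by (intro integral_sum finite_lessThan integrable_poly_prod)
  have deg: "degree (l k) = k" and lc: "coeff (l k) k = 1" if "k < n" for k
    using l[OF that] by (auto simp: is_monic_legendre_def)
  have orth: "ip (l i) (l j) = 0" if "i < n" "j < n" "i \<noteq> j" for i j
  proof (cases "j < i")
    case True
    then show ?thesis
      unfolding ip_def using l that deg by (intro legendre_orth_lower) auto
  next
    case False
    then show ?thesis
      unfolding ip_commute[of "l i"] unfolding ip_def
      using l that deg by (intro legendre_orth_lower) auto
  qed
  have pos: "ip (l k) (l k) \<noteq> 0" if "k < n" for k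
    using poly_sq_integral_eq_0[of "l k"] lc[OF that] by (auto simp: ip_def)
  define s where "s = (\<Sum>k<n. smult (ip (monom 1 n) (l k) / ip (l k) (l k)) (l k))"
  define p where "p = monom 1 n - s"
  have s0: "coeff s i = 0" if "i \<ge> n" for i
    unfolding s_def coeff_sum using that deg by (intro sum.neutral) (auto intro: coeff_eq_0)
  have cn: "coeff p n = 1" using s0 by (simp add: p_def)
  have "degree p \<le> n"
    by (intro degree_le) (auto simp: p_def s0)
  moreover have "n \<le> degree p" using cn by (intro le_degree) simp
  ultimately have dp: "degree p = n" by simp
  have pl: "ip p (l j) = 0" if "j < n" for j
  proof -
    have "ip s (l j) = (\<Sum>k<n. ip (monom 1 n) (l k) / ip (l k) (l k) * ip (l k) (l j))"
      unfolding s_def ip_sum ip_smult ..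
    also have "\<dots> = (\<Sum>k\<in>{j}. ip (monom 1 n) (l k) / ip (l k) (l k) * ip (l k) (l j))"
      using that orth by (intro sum.mono_neutral_right) auto
    also have "\<dots> = ip (monom 1 n) (l j)" using pos[OF that] by simp
    finally show ?thesis by (simp add: p_def ip_diff)
  qed
  have low: "ip p q = 0" if "q = 0 \<or> degree q < n" for q
    using that
  proof (induction "degree q" arbitrary: q rule: less_induct)
    case (less q)
    show ?case
    proof (cases "q = 0")
      case True
      then show ?thesis by (simp add: ip_def)
    next
      case False
      with less.prems have dq: "degree q < n" by simp
      define r where "r = q - smult (lead_coeff q) (l (degree q))"
      have "degree r \<le> degree q"
        unfolding r_def using deg[OF dq] by (intro degree_diff_le) auto
      moreover have "coeff r (degree q) = 0" using lc[OF dq] by (simp add: r_def)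
      ultimately have "r = 0 \<or> degree r < degree q"
        by (metis leading_coeff_0_iff nat_less_le)
      then have "ip p r = 0"
        using less.hyps[of r] dq by (auto simp: ip_def)
      moreover have "ip r p = ip q p - lead_coeff q * ip (l (degree q)) p"
        by (simp add: r_def ip_diff ip_smult)
      ultimately show ?thesis
        using pl[OF dq] by (simp add: ip_commute)
    qed
  qed
  have "integral {-1..1} (\<lambda>x. poly p x * x ^ k) = 0" if "k < n" for k
    using low[of "monom 1 k"] that by (simp add: ip_def degree_monom_eq poly_monom)
  with dp cn show ?case by (auto simp: is_monic_legendre_def)
qed

lemma is_monic_legendre_monic_legendre: "is_monic_legendre n (monic_legendre n)"
  unfolding monic_legendre_def
  by (rule theI') (use ex_is_monic_legendre is_monic_legendre_unique in blast)

lemma is_polar_legendre_unique: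
  assumes "is_polar_legendre \<zeta> n p" and "is_polar_legendre \<zeta> n q"
  shows "p = q"
proof -
  have "pderiv ([:- \<zeta>, 1:] * (p - q)) = 0"
    using assms by (simp only: is_polar_legendre_def right_diff_distrib pderiv_diff) simp
  then have "degree ([:- \<zeta>, 1:] * (p - q)) = 0"
    by (simp only: pderiv_eq_0_iff)
  then have "p - q = 0"
    by (rule contrapos_pp) (subst degree_mult_eq; simp)
  then show ?thesis by simp
qed

lemma ex_is_polar_legendre: "\<exists>p. is_polar_legendre \<zeta> n p"
proof -
  define f where "f = complex_poly (monic_legendre n)"
  have f: "degree f = n" "coeff f n = 1"
    using is_monic_legendre_monic_legendre[of n]
    by (auto simp: f_def complex_poly_def is_monic_legendre_def coeff_map_poly
        intro!: map_poly_degree_eq[where f = complex_of_real, THEN trans])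
  define F where "F = (\<Sum>k\<le>n. monom (of_nat (n + 1) * coeff f k / of_nat (k + 1)) (k + 1))"
  have cF: "coeff F (Suc k) = of_nat (n + 1) * coeff f k / of_nat (k + 1)" for k
  proof (cases "k \<le> n")
    case True
    then show ?thesis by (simp add: F_def coeff_sum sum.delta' eq_commute)
  next
    case False
    then have "coeff f k = 0" using f by (intro coeff_eq_0) simp
    then show ?thesis by (simp add: F_def coeff_sum sum.neutral)
  qed
  have dF: "pderiv F = smult (of_nat (n + 1)) f"
    by (rule poly_eqI)
       (simp add: coeff_pderiv cF del: of_nat_Suc of_nat_add)
  define G where "G = F - [:poly F \<zeta>:]"
  have "poly G \<zeta> = 0" by (simp add: G_def)
  then obtain p where p: "G = [:- \<zeta>, 1:] * p"
    by (auto simp: poly_eq_0_iff_dvd)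
  have cG: "coeff G (Suc k) = coeff F (Suc k)" for k by (simp add: G_def)
  have "of_nat (n + 1) \<noteq> (0 :: complex)" unfolding of_nat_eq_0_iff by simp
  then have lG: "coeff G (Suc n) = 1" using f by (simp add: cG cF)
  have "degree G \<le> Suc n"
  proof (rule degree_le, intro allI impI)
    fix i assume "Suc n < i"
    then obtain j where "i = Suc j" "n < j" by (cases i) auto
    then show "coeff G i = 0" using f by (simp add: cG cF coeff_eq_0)
  qed
  with lG have G: "degree G = Suc n" by (metis le_antisym le_degree zero_neq_one)
  have "p \<noteq> 0" using lG p by auto
  have d: "degree p = n"
    using G \<open>p \<noteq> 0\<close> unfolding p by (subst (asm) degree_mult_eq) auto
  moreover have "lead_coeff p = 1"
    using lG G unfolding p by (metis lead_coeff_mult lead_coeff_pCons(1) lead_coeff_1 mult_1 one_neq_zero pCons_one)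
  moreover have "pderiv ([:- \<zeta>, 1:] * p) = smult (of_nat (n + 1)) f"
    unfolding p[symmetric] by (simp only: G_def pderiv_diff dF) (simp add: pderiv_pCons)
  ultimately show ?thesis by (auto simp: is_polar_legendre_def f_def)
qed

lemma is_polar_legendre_polar_legendre: "is_polar_legendre \<zeta> n (polar_legendre \<zeta> n)"
  unfolding polar_legendre_def
  by (rule theI') (use ex_is_polar_legendre is_polar_legendre_unique in blast)

end

theory Submission
  imports Defs
begin

text \<open>
  The monic Legendre polynomial satisfies the differential equation
  \<open>((x\<^sup>2 - 1) L\<^sub>n')' = n (n + 1) L\<^sub>n\<close>. Hence \<open>(z\<^sup>2 - 1) L\<^sub>n'\<close> is, up to an additive constant, \<open>n\<close> times the
  antiderivative \<open>(z - \<zeta>) P\<^sub>n\<close> of \<open>(n + 1) L\<^sub>n\<close>, and for \<open>n > 0\<close> vanishing at \<open>\<zeta>\<close> fixes it as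
  (\<open>polar_legendre_closed_form\<close>):
  \<open>(z - \<zeta>) P\<^sub>n = ((z\<^sup>2 - 1) L\<^sub>n' + (1 - \<zeta>\<^sup>2) L\<^sub>n'(\<zeta>)) / n\<close>.

  The second integral therefore splits into two parts. The constant is seen by \<open>L\<^sub>0\<close> only,
  which gives the value for \<open>m = 0\<close>. The pole no longer occurs in the other part, the integral
  of \<open>(x\<^sup>2 - 1) L\<^sub>n' L\<^sub>m\<close>. It is computed from the one consequence of orthogonality used
  throughout, that \<open>L\<^sub>k\<close> sees of a polynomial of degree at most \<open>k\<close> only the coefficient of
  \<open>x\<^sup>k\<close> (\<open>poly_integral_monic_legendre_mult\<close>): apply it to \<open>L\<^sub>m\<close> if \<open>m > n\<close>, and
  to \<open>L\<^sub>n\<close>, after an integration by parts without boundary terms, if \<open>m < n\<close>; for \<open>m = n\<close>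
  the same integration by parts leads to the integral of the odd polynomial \<open>x L\<^sub>n\<^sup>2\<close>.

  When \<open>n = 1\<close>, the indices \<open>0\<close> and \<open>n - 1\<close> coincide and both contributions are present,
  so their sum appears.

  The first integral is immediate, since \<open>P\<^sub>n + (x - \<zeta>) P\<^sub>n'\<close> is the derivative
  \<open>(n + 1) L\<^sub>n\<close> of \<open>(x - \<zeta>) P\<^sub>n\<close>.
\<close>

section \<open>The integral as a linear functional on polynomials\<close>

definition poly_integral :: "real poly \<Rightarrow> real" where
  "poly_integral p = integral {-1..1} (poly p)"

lemma poly_integrable: "poly p integrable_on {-1..1::real}"
  by (intro integrable_continuous_interval continuous_intros)

lemma poly_integral_add: "poly_integral (p + q) = poly_integral p + poly_integral q"
  using integral_add[OF poly_integrable poly_integrable, of p q]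
  by (simp add: poly_integral_def poly_add[abs_def])

lemma poly_integral_diff: "poly_integral (p - q) = poly_integral p - poly_integral q"
  using integral_diff[OF poly_integrable poly_integrable, of p q]
  by (simp add: poly_integral_def poly_diff[abs_def])

lemma poly_integral_smult: "poly_integral (smult c p) = c * poly_integral p"
  by (simp add: poly_integral_def poly_smult[abs_def])

lemma poly_integral_uminus: "poly_integral (- p) = - poly_integral p"
  using poly_integral_smult[of "-1" p] by simp

lemma poly_integral_pderiv: "poly_integral (pderiv p) = poly p 1 - poly p (- 1)"
  unfolding poly_integral_def
  by (intro integral_unique fundamental_theorem_of_calculus)
     (auto intro!: derivative_eq_intros simp flip: has_real_derivative_iff_has_vector_derivative)

lemma poly_integral_pcompose_minus: "poly_integral (pcompose p [:0, - 1:]) = poly_integral p"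
proof -
  have "poly (pcompose p [:0, - 1:]) = (\<lambda>x. poly p (- x))"
    by (simp add: fun_eq_iff poly_pcompose)
  then show ?thesis
    using Henstock_Kurzweil_Integration.integral_reflect_real[of 1 "- 1" "poly p"]
    by (simp add: poly_integral_def)
qed

text \<open>The factor \<open>x\<^sup>2 - 1\<close> vanishes at both endpoints, so that no boundary terms appear.\<close>

lemma poly_integral_by_parts:
  "poly_integral ([:- 1, 0, 1:] * pderiv p * q) = - poly_integral (p * pderiv ([:- 1, 0, 1:] * q))"
proof -
  have "pderiv ([:- 1, 0, 1:] * q * p) =
      [:- 1, 0, 1:] * pderiv p * q + p * pderiv ([:- 1, 0, 1:] * q)"
    by (subst pderiv_mult) (simp add: algebra_simps)
  moreover have "poly_integral (pderiv ([:- 1, 0, 1:] * q * p)) = 0"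
    unfolding poly_integral_pderiv by simp
  ultimately show ?thesis by (simp only: poly_integral_add)
qed

lemma degree_pderiv_le: "degree (pderiv p) \<le> degree p - 1"
  by (rule degree_le) (auto simp: coeff_pderiv coeff_eq_0)

lemma coeff_square_minus_one_mult:
  "coeff ([:- 1, 0, 1:] * p :: 'a :: comm_ring_1 poly) (Suc (Suc k)) =
     coeff p k - coeff p (Suc (Suc k))"
  by simp

lemma degree_pderiv_square_minus_one_mult:
  "degree (pderiv ([:- 1, 0, 1:] * p :: 'a :: {comm_ring_1, ring_no_zero_divisors} poly)) \<le> degree p + 1"
proof -
  have "degree ([:- 1, 0, 1:] * p :: 'a poly) \<le> degree p + 2"
    using degree_mult_le[of "[:- 1, 0, 1:]" p] by simp
  with degree_pderiv_le[of "[:- 1, 0, 1:] * p"] show ?thesis by linarith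
qed

section \<open>Orthogonality, parity and the Legendre equation\<close>

lemma degree_monic_legendre [simp]: "degree (monic_legendre n) = n"
  and coeff_monic_legendre_self [simp]: "coeff (monic_legendre n) n = 1"
  using is_monic_legendre_monic_legendre[of n] by (auto simp: is_monic_legendre_def)

lemma monic_legendre_0: "monic_legendre 0 = 1"
  using degree_monic_legendre[of 0] coeff_monic_legendre_self[of 0]
  by (metis degree_0_id of_nat_1 one_pCons)

lemma legendre_norm_sq_0: "legendre_norm_sq 0 = 2"
  by (simp add: legendre_norm_sq_def monic_legendre_0)

lemma is_monic_legendreI:
  assumes "degree p = n" "coeff p n = 1"
    and "\<And>q. q = 0 \<or> degree q < n \<Longrightarrow> poly_integral (p * q) = 0"
  shows "is_monic_legendre n p"
  using assms(1,2) assms(3)[of "monom 1 k" for k]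
  by (auto simp: is_monic_legendre_def poly_integral_def poly_mult[abs_def] poly_monom
      degree_monom_eq)

lemma poly_integral_monic_legendre_mult_lower:
  assumes "degree q < n \<or> q = 0"
  shows "poly_integral (monic_legendre n * q) = 0"
  using legendre_orth_lower[OF is_monic_legendre_monic_legendre assms]
  by (simp add: poly_integral_def poly_mult[abs_def])

text \<open>
  Subtracting from \<open>q\<close> the multiple of \<open>L\<^sub>n\<close> with the same coefficient of \<open>x\<^sup>n\<close> leaves a
  polynomial of degree below \<open>n\<close>, which is orthogonal to \<open>L\<^sub>n\<close>.
\<close>

lemma poly_integral_monic_legendre_mult:
  assumes "degree q \<le> n"
  shows "poly_integral (monic_legendre n * q) = coeff q n * legendre_norm_sq n"
proof -
  define r where "r = q - smult (coeff q n) (monic_legendre n)"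
  have "degree r \<le> n"
    unfolding r_def using assms by (intro degree_diff_le) auto
  moreover have "coeff r n = 0" by (simp add: r_def)
  ultimately have "degree r < n \<or> r = 0"
    by (metis leading_coeff_0_iff nat_less_le)
  then have "poly_integral (monic_legendre n * r) = 0"
    by (rule poly_integral_monic_legendre_mult_lower)
  then show ?thesis
    by (simp add: r_def right_diff_distrib poly_integral_diff poly_integral_smult)
       (simp add: poly_integral_def legendre_norm_sq_def power2_eq_square poly_mult[abs_def])
qed

corollary poly_integral_monic_legendre:
  "poly_integral (monic_legendre m) = (if m = 0 then 2 else 0)"
  using poly_integral_monic_legendre_mult[of 1 m] by (simp add: legendre_norm_sq_0)

corollary poly_integral_monic_legendre_mult_monic_legendre:
  "poly_integral (monic_legendre n * monic_legendre m) = (if m = n then legendre_norm_sq n else 0)"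
proof (cases "m \<le> n")
  case True
  then show ?thesis
    using poly_integral_monic_legendre_mult[of "monic_legendre m" n] by (auto simp: coeff_eq_0)
next
  case False
  then show ?thesis
    using poly_integral_monic_legendre_mult_lower[of "monic_legendre n" m]
    by (auto simp: mult.commute)
qed

text \<open>
  The interval and the space of polynomials of degree below \<open>n\<close> are symmetric under
  \<open>x \<mapsto> - x\<close>, so by uniqueness \<open>(- 1)\<^sup>n L\<^sub>n(- x)\<close> is \<open>L\<^sub>n\<close>.
\<close>

lemma pcompose_minus_monic_legendre:
  "pcompose (monic_legendre n) [:0, - 1:] = smult ((- 1) ^ n) (monic_legendre n)"
proof -
  let ?L = "monic_legendre n"
  let ?p = "smult ((- 1) ^ n) (pcompose ?L [:0, - 1:])"
  have "is_monic_legendre n ?p"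
  proof (rule is_monic_legendreI)
    show "degree ?p = n" by (simp add: degree_pcompose)
    have "coeff (pcompose ?L [:0, - 1:]) n = (- 1) ^ n"
      using lead_coeff_comp[of "[:0, - 1:]" ?L] by (simp add: degree_pcompose)
    then show "coeff ?p n = 1" by (simp flip: power_add mult_2)
  next
    fix q :: "real poly"
    assume q: "q = 0 \<or> degree q < n"
    have "pcompose (?L * pcompose q [:0, - 1:]) [:0, - 1:] = pcompose ?L [:0, - 1:] * q"
      by (simp add: pcompose_mult flip: pcompose_assoc) (simp add: pcompose_pCons)
    then have "poly_integral (pcompose ?L [:0, - 1:] * q) =
        poly_integral (?L * pcompose q [:0, - 1:])"
      by (metis poly_integral_pcompose_minus)
    also have "\<dots> = 0"
      using q by (intro poly_integral_monic_legendre_mult_lower) (auto simp: degree_pcompose)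
    finally show "poly_integral (?p * q) = 0" by (simp add: poly_integral_smult)
  qed
  then have "?p = ?L"
    using is_monic_legendre_monic_legendre is_monic_legendre_unique by blast
  then have "smult ((- 1) ^ n) ?p = smult ((- 1) ^ n) ?L" by simp
  then show ?thesis by (simp flip: power_add mult_2)
qed

lemma poly_integral_x_mult_monic_legendre_square:
  "poly_integral ([:0, 1:] * (monic_legendre n * monic_legendre n)) = 0"
proof -
  let ?p = "[:0, 1:] * (monic_legendre n * monic_legendre n)"
  have "pcompose ?p [:0, - 1:] = - ?p"
    by (simp only: pcompose_mult pcompose_minus_monic_legendre)
       (simp add: pcompose_pCons flip: power_add mult_2)
  then have "poly_integral ?p = - poly_integral ?p"
    by (metis poly_integral_pcompose_minus poly_integral_uminus)
  then show ?thesis by linarith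
qed

text \<open>
  The operator \<open>p \<mapsto> ((x\<^sup>2 - 1) p')'\<close> is symmetric for the integral inner product and does not
  raise degrees. It therefore maps \<open>L\<^sub>n\<close> to a polynomial of degree \<open>n\<close> orthogonal to all lower
  degrees, that is, to a multiple of \<open>L\<^sub>n\<close>; comparing leading coefficients gives the factor.
\<close>

lemma monic_legendre_differential_equation:
  assumes "n > 0"
  shows "pderiv ([:- 1, 0, 1:] * pderiv (monic_legendre n)) =
    smult (of_nat (n * (n + 1))) (monic_legendre n)"
proof -
  let ?L = "monic_legendre n"
  let ?W = "[:- 1, 0, 1:] :: real poly"
  let ?c = "of_nat (n * (n + 1)) :: real"
  define p where "p = pderiv (?W * pderiv ?L)"
  have c: "?c \<noteq> 0" using assms unfolding of_nat_eq_0_iff by simp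
  have coeff_p: "coeff p n = ?c"
  proof -
    from assms obtain k where k: "n = Suc k" by (cases n) auto
    have "coeff ?L (Suc (Suc (Suc k))) = 0" by (intro coeff_eq_0) (simp add: k)
    then show ?thesis
      using coeff_monic_legendre_self[of n]
      unfolding p_def coeff_pderiv k coeff_square_minus_one_mult
      by (simp add: algebra_simps)
  qed
  have "degree p \<le> n"
    using degree_pderiv_square_minus_one_mult[of "pderiv ?L"] degree_pderiv_le[of ?L] assms
    unfolding p_def degree_monic_legendre by linarith
  moreover have "n \<le> degree p" using coeff_p c by (intro le_degree) simp
  ultimately have deg: "degree p = n" by simp
  have "is_monic_legendre n (smult (1 / ?c) p)"
  proof (rule is_monic_legendreI)
    show "degree (smult (1 / ?c) p) = n" "coeff (smult (1 / ?c) p) n = 1"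
      using deg coeff_p c by auto
  next
    fix q :: "real poly"
    assume q: "q = 0 \<or> degree q < n"
    have "poly_integral (pderiv (?W * pderiv ?L) * q) = poly_integral (?L * pderiv (?W * pderiv q))"
      using poly_integral_by_parts[of q "pderiv ?L"] poly_integral_by_parts[of ?L "pderiv q"]
      by (simp only: mult_ac)
    also have "\<dots> = 0"
    proof (cases "pderiv q = 0")
      case False
      then have "degree q \<noteq> 0" by (simp add: pderiv_eq_0_iff)
      then have "degree (pderiv (?W * pderiv q)) < n"
        using degree_pderiv_square_minus_one_mult[of "pderiv q"] degree_pderiv_le[of q] q by auto
      then show ?thesis by (intro poly_integral_monic_legendre_mult_lower disjI1)
    qed (intro poly_integral_monic_legendre_mult_lower, simp)
    finally show "poly_integral (smult (1 / ?c) p * q) = 0"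
      by (simp add: p_def poly_integral_smult)
  qed
  then have "smult (1 / ?c) p = ?L"
    using is_monic_legendre_monic_legendre is_monic_legendre_unique by blast
  then have "smult ?c (smult (1 / ?c) p) = smult ?c ?L" by (rule arg_cong)
  then show ?thesis using c by (simp add: p_def del: of_nat_mult)
qed

section \<open>The Legendre expansion of the pole-free part\<close>

lemma poly_integral_pderiv_monic_legendre:
  assumes "n > 0"
  shows "poly_integral ([:- 1, 0, 1:] * pderiv (monic_legendre n) * monic_legendre m) =
    (if m = n - 1 then - of_nat (n + 1) * legendre_norm_sq n
     else if m = n + 1 then of_nat n * legendre_norm_sq (n + 1) else 0)"
proof -
  let ?W = "[:- 1, 0, 1:] :: real poly"
  let ?L = monic_legendre
  from assms obtain k where k: "n = Suc k" by (cases n) auto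
  consider "m < n" | "m = n" | "n < m" by linarith
  then show ?thesis
  proof cases
    case 1
    have "degree (pderiv (?W * ?L m)) \<le> n"
      using degree_pderiv_square_minus_one_mult[of "?L m"] 1 unfolding degree_monic_legendre by linarith
    then have "poly_integral (?W * pderiv (?L n) * ?L m) =
        - (coeff (pderiv (?W * ?L m)) n * legendre_norm_sq n)"
      unfolding poly_integral_by_parts by (simp only: poly_integral_monic_legendre_mult)
    moreover have "coeff (pderiv (?W * ?L m)) n = (if m = n - 1 then of_nat (n + 1) else 0)"
      using 1 unfolding coeff_pderiv k coeff_square_minus_one_mult by (auto simp: coeff_eq_0)
    ultimately show ?thesis using 1 by (auto simp: algebra_simps)
  next
    case 2
    \<comment> \<open>Integrating by parts gives the negative of the same integral, plus an odd term:
      the integral equals its own negative.\<close>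
    have "pderiv (?W * ?L n) = smult 2 ([:0, 1:] * ?L n) + ?W * pderiv (?L n)"
      by (subst pderiv_mult) (simp add: pderiv_pCons algebra_simps)
    then have "?L n * pderiv (?W * ?L n) =
        smult 2 ([:0, 1:] * (?L n * ?L n)) + ?W * pderiv (?L n) * ?L n"
      by (simp only: distrib_left mult_smult_right mult_ac)
    then have "poly_integral (?L n * pderiv (?W * ?L n)) =
        poly_integral (?W * pderiv (?L n) * ?L n)"
      by (simp only: poly_integral_add poly_integral_smult
          poly_integral_x_mult_monic_legendre_square)
    with poly_integral_by_parts[of "?L n" "?L n"] show ?thesis using 2 assms by simp
  next
    case 3
    have "degree (?W * pderiv (?L n)) \<le> m"
      using degree_mult_le[of ?W "pderiv (?L n)"] degree_pderiv_le[of "?L n"] 3 assms by simp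
    then have "poly_integral (?W * pderiv (?L n) * ?L m) =
        coeff (?W * pderiv (?L n)) m * legendre_norm_sq m"
      by (simp only: poly_integral_monic_legendre_mult mult.commute[of _ "?L m"])
    moreover have "coeff (?W * pderiv (?L n)) m = (if m = n + 1 then of_nat n else 0)"
    proof -
      from 3 k obtain j where j: "m = Suc (Suc j)" "k \<le> j"
        by (metis Suc_le_D Suc_le_eq Suc_le_mono)
      then have "coeff (?L n) (Suc (Suc (Suc j))) = 0" by (intro coeff_eq_0) (simp add: k)
      moreover have "coeff (?L n) (Suc j) = (if m = n + 1 then 1 else 0)"
        using j coeff_monic_legendre_self[of n] by (auto simp: k coeff_eq_0)
      ultimately show ?thesis
        unfolding j coeff_square_minus_one_mult coeff_pderiv using j by (auto simp: k)
    qed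
    ultimately show ?thesis using 3 by auto
  qed
qed

section \<open>The closed form of the polar polynomial\<close>

lemma complex_poly_mult: "complex_poly (p * q) = complex_poly p * complex_poly q"
  by (rule poly_eqI) (simp add: complex_poly_def coeff_map_poly coeff_mult)

lemma complex_poly_smult: "complex_poly (smult c p) = smult (of_real c) (complex_poly p)"
  by (rule poly_eqI) (simp add: complex_poly_def coeff_map_poly)

lemma pderiv_complex_poly: "pderiv (complex_poly p) = complex_poly (pderiv p)"
  by (rule poly_eqI) (simp add: complex_poly_def coeff_map_poly coeff_pderiv)

lemma poly_complex_poly_of_real: "poly (complex_poly p) (of_real x) = of_real (poly p x)"
  by (induction p) (simp_all add: complex_poly_def map_poly_pCons)

lemma poly_eq_if_pderiv_eq:
  fixes p q :: "'a :: {idom, semiring_char_0} poly"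
  assumes "pderiv p = pderiv q" "poly p a = poly q a"
  shows "p = q"
proof -
  have "degree (p - q) = 0"
    using assms(1) by (simp add: pderiv_eq_0_iff[symmetric] pderiv_diff)
  then obtain c where c: "p - q = [:c:]" by (meson degree_eq_zeroE)
  then have "c = 0" using assms(2) by (metis poly_diff poly_pCons poly_0 mult_zero_right add.right_neutral right_minus_eq)
  with c show ?thesis by simp
qed

lemma pderiv_polar_legendre:
  "pderiv ([:- \<zeta>, 1:] * polar_legendre \<zeta> n) =
    smult (of_nat (n + 1)) (complex_poly (monic_legendre n))"
  using is_polar_legendre_polar_legendre[of \<zeta> n] by (simp add: is_polar_legendre_def)

text \<open>Both sides have the same derivative, by the Legendre equation, and vanish at \<open>\<zeta>\<close>.\<close>

lemma polar_legendre_closed_form: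
  assumes "n > 0"
  shows "smult (of_nat n) ([:- \<zeta>, 1:] * polar_legendre \<zeta> n) =
    complex_poly ([:- 1, 0, 1:] * pderiv (monic_legendre n)) +
    [:(1 - \<zeta>\<^sup>2) * poly (pderiv (complex_poly (monic_legendre n))) \<zeta>:]"
proof (rule poly_eq_if_pderiv_eq[where a = \<zeta>])
  let ?L = "monic_legendre n"
  show "pderiv (smult (of_nat n) ([:- \<zeta>, 1:] * polar_legendre \<zeta> n)) =
      pderiv (complex_poly ([:- 1, 0, 1:] * pderiv ?L) +
        [:(1 - \<zeta>\<^sup>2) * poly (pderiv (complex_poly ?L)) \<zeta>:])"
    unfolding pderiv_smult pderiv_polar_legendre pderiv_add pderiv_complex_poly
      monic_legendre_differential_equation[OF assms] complex_poly_smult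
    by (simp add: pderiv_pCons algebra_simps)
  have "poly (complex_poly [:- 1, 0, 1:]) \<zeta> = \<zeta>\<^sup>2 - 1"
    by (simp add: complex_poly_def map_poly_pCons power2_eq_square)
  then show "poly (smult (of_nat n) ([:- \<zeta>, 1:] * polar_legendre \<zeta> n)) \<zeta> =
      poly (complex_poly ([:- 1, 0, 1:] * pderiv ?L) +
        [:(1 - \<zeta>\<^sup>2) * poly (pderiv (complex_poly ?L)) \<zeta>:]) \<zeta>"
    by (simp only: complex_poly_mult pderiv_complex_poly poly_add poly_mult)
       (simp add: algebra_simps)
qed

section \<open>The two integrals\<close>

lemma has_integral_of_real_poly:
  "((\<lambda>x. complex_of_real (poly p x)) has_integral of_real (poly_integral p)) {-1..1}"
  unfolding poly_integral_def
  by (intro has_integral_of_real integrable_integral poly_integrable)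

lemma has_integral_pderiv_polar_legendre:
  "((\<lambda>x::real. (poly (polar_legendre \<zeta> n) (of_real x)
        + (of_real x - \<zeta>) * poly (pderiv (polar_legendre \<zeta> n)) (of_real x))
        * of_real (poly q x))
    has_integral of_nat (n + 1) * of_real (poly_integral (monic_legendre n * q))) {-1..1}"
proof -
  have "poly (polar_legendre \<zeta> n) z + (z - \<zeta>) * poly (pderiv (polar_legendre \<zeta> n)) z =
      poly (pderiv ([:- \<zeta>, 1:] * polar_legendre \<zeta> n)) z" for z
    by (subst pderiv_mult) (simp add: pderiv_pCons algebra_simps)
  then have "(poly (polar_legendre \<zeta> n) (of_real x)
        + (of_real x - \<zeta>) * poly (pderiv (polar_legendre \<zeta> n)) (of_real x))
        * of_real (poly q x) =
      of_nat (n + 1) * of_real (poly (monic_legendre n * q) x)" for x :: real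
    by (simp only: pderiv_polar_legendre poly_smult poly_complex_poly_of_real poly_mult
        of_real_mult mult.assoc)
  then show ?thesis
    by (simp only: has_integral_mult_right[OF has_integral_of_real_poly])
qed

lemma has_integral_polar_legendre:
  assumes "n > 0"
  shows "((\<lambda>x::real. (of_real x - \<zeta>) * poly (polar_legendre \<zeta> n) (of_real x) * of_real (poly q x))
    has_integral
      of_real (poly_integral ([:- 1, 0, 1:] * pderiv (monic_legendre n) * q)) / of_nat n +
      (1 - \<zeta>\<^sup>2) * poly (pderiv (complex_poly (monic_legendre n))) \<zeta> / of_nat n *
        of_real (poly_integral q)) {-1..1}"
proof -
  let ?R = "[:- 1, 0, 1:] * pderiv (monic_legendre n)"
  let ?K = "(1 - \<zeta>\<^sup>2) * poly (pderiv (complex_poly (monic_legendre n))) \<zeta>"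
  have "of_nat n * ((of_real x - \<zeta>) * poly (polar_legendre \<zeta> n) (of_real x)) =
      of_real (poly ?R x) + ?K" for x :: real
    using arg_cong[OF polar_legendre_closed_form[OF assms, of \<zeta>], of "\<lambda>p. poly p (of_real x)"]
    unfolding poly_add poly_complex_poly_of_real by (simp add: algebra_simps)
  then have "(of_real x - \<zeta>) * poly (polar_legendre \<zeta> n) (of_real x) =
      (of_real (poly ?R x) + ?K) / of_nat n" for x :: real
    using assms by (metis nonzero_mult_div_cancel_left of_nat_eq_0_iff less_irrefl)
  then have "(of_real x - \<zeta>) * poly (polar_legendre \<zeta> n) (of_real x) * of_real (poly q x) =
      of_real (poly (?R * q) x) / of_nat n + ?K / of_nat n * of_real (poly q x)" for x :: real
    by (simp only: poly_mult of_real_mult) (simp only: times_divide_eq_left times_divide_eq_right distrib_right add_divide_distrib)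
  then show ?thesis
    by (simp only: has_integral_add[OF has_integral_divide[OF has_integral_of_real_poly]
          has_integral_mult_right[OF has_integral_of_real_poly]])
qed

theorem theorem1:
  fixes \<zeta> :: complex and n m :: nat
  shows
    "integral {-1..1}
       (\<lambda>x::real. (poly (polar_legendre \<zeta> n) (of_real x)
                 + (of_real x - \<zeta>) * poly (pderiv (polar_legendre \<zeta> n)) (of_real x))
              * of_real (poly (monic_legendre m) x))
     = (if m \<noteq> n then 0 else of_nat (n + 1) * of_real (legendre_norm_sq n))
     \<and>
     (n > 0 \<longrightarrow>
      integral {-1..1}
        (\<lambda>x::real. (of_real x - \<zeta>) * poly (polar_legendre \<zeta> n) (of_real x)
               * of_real (poly (monic_legendre m) x))
      = (if m = 0 \<and> m = n - 1 then
           2 / of_nat n * (1 - \<zeta>\<^sup>2) * poly (pderiv (complex_poly (monic_legendre n))) \<zeta>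
           - of_nat (n + 1) / of_nat n * of_real (legendre_norm_sq n)
         else if m = 0 then
           2 / of_nat n * (1 - \<zeta>\<^sup>2) * poly (pderiv (complex_poly (monic_legendre n))) \<zeta>
         else if m < n - 1 then 0
         else if m = n - 1 then - of_nat (n + 1) / of_nat n * of_real (legendre_norm_sq n)
         else if m = n then 0
         else if m = n + 1 then of_real (legendre_norm_sq (n + 1))
         else 0))"
proof (intro conjI impI, goal_cases)
  case 1
  show ?case
    unfolding integral_unique[OF has_integral_pderiv_polar_legendre]
      poly_integral_monic_legendre_mult_monic_legendre by simp
next
  case 2
  then show ?case
    unfolding integral_unique[OF has_integral_polar_legendre[OF 2]]
      poly_integral_pderiv_monic_legendre[OF 2] poly_integral_monic_legendre
    by (auto simp: algebra_simps diff_divide_distrib add_divide_distrib)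
qed

end
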